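(* Assume that $(R;\lambda,\mu)\in\mathbb{R}^{n\times r}\times\mathbb{R}^{m\times r}\times\mathbb{R}^{|B|}$ satisfies the KKT conditions $$2LR+q e_1^\top-A^\top\lambda=0,\qquad AR=be_1^\top,\qquad \operatorname{diag}_B(RR^\top)-R_Be_1=0$$ of the problem $\min\{f_r(R): R\in\mathcal{M}_r\}$, where, with $\sigma>0$ and $\widetilde W\in\mathbb{S}^{n+1}$ fixed, $$Y:=\widehat R\widehat R^\top,\quad Z:=\Pi_{\mathcal P}(Y-\sigma^{-1}\widetilde W),\quad W:=\sigma\Pi_{\mathcal P^*}(\sigma^{-1}\widetilde W-Y),$$ $$L:=Q-\operatorname{diag}_B^*(\mu)-W_{22},\qquad q:=2c+\operatorname{diag}_B^*(\mu)e-2W_{21}.$$ Define further $A^\dagger:=A^\top(AA^\top)^{-1}$, $J_A:=I-A^\dagger A$, $$\lambda_1:=(A^\dagger)^\top(q+LA^\dagger b)\in\mathbb{R}^m,\quad \lambda_2:=(A^\dagger)^\top L(2I-A^\dagger A)\in\mathbb{R}^{m\times n},$$ $$\alpha:=-(J_ARe_1)^\top L(J_ARe_1)-W_{11},\quad y:=(\lambda_1;\operatorname{vec}(\lambda_2);\mu;\alpha),\quad S:=C-\mathcal{A}^*(y)-W.$$ Then $$S=\begin{pmatrix}-(Re_1)^\top \\ I\end{pmatrix}J_ALJ_A\begin{pmatrix}-Re_1& I\end{pmatrix}.$$ Moreover, the following statements hold. 1. $(R;\lambda_1,\lambda_2,\mu)$ satisfies the KKT conditions of the problem $\min\{f_r(R):R\in\mathcal{N}_r\}$,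 namely $$2LR+qe_1^\top-\big(A^\top\lambda_1e_1^\top+A^\top\lambda_2R+\lambda_2^\top AR-\lambda_2^\top be_1^\top\big)=0,$$ $$ARe_1=b,\quad ARR^\top=b(Re_1)^\top,\quad \operatorname{diag}_B(RR^\top)=R_Be_1.$$ 2. $(Y;y,S)$ satisfies all the KKT conditions of the problem $\min\{\phi(Y):\mathcal{A}(Y)=d,\ Y\in\mathbb{S}^{n+1}_+\}$ except possibly $S\succeq0$; that is, $\mathcal{A}(Y)=d$, $Y\succeq 0$, $C-\mathcal{A}^*(y)-S-W=0$ and $\langle S,Y\rangle=0$. 3. $(Y,Z;y,S,W)$ satisfies all the KKT conditions of the problem $\min\{\langle C,Y\rangle: Y-Z=0,\ \mathcal{A}(Y)=d,\ Y\in\mathbb{S}^{n+1}_+,\ Z\in\mathcal P\}$ except possibly $S\succeq0$ and $Y-Z=0$; that is, $\mathcal{A}(Y)=d$, $C-\mathcal{A}^*(y)-S-W=0$, $\langle Y,S\rangle=0$, $Y\succeq0$, $\langle Z,W\rangle=0$, $Z\in\mathcal P$, $W\in\mathcal P^*$.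
   Context: Data: $n,m,r$ are positive integers, $Q\in\mathbb{S}^n$ (real symmetric $n\times n$ matrices), $c\in\mathbb{R}^n$, $A\in\mathbb{R}^{m\times n}$ has full row rank, $b\in\mathbb{R}^m$ with $b\ge0$, $B\subseteq[n]=\{1,\dots,n\}$ is an index set, $C=\begin{pmatrix}0&c^\top \\ c&Q\end{pmatrix}\in\mathbb{S}^{n+1}$, and $\mathcal P\subseteq\mathbb{S}^{n+1}$ is a polyhedral convex cone with dual cone $\mathcal P^*=\{X:\langle X,Y\rangle\ge0\ \forall Y\in\mathcal P\}$. Here $\langle X,Y\rangle=\operatorname{Tr}(XY^\top)$, and $\Pi_{\mathcal C}$ is the orthogonal projection onto a closed convex set $\mathcal C$. $\mathbb{S}^{n+1}_+$ is the cone of positive semidefinite matrices. Notation: $e$ is the all-ones vector, $e_1$ the first standard unit vector (of $\mathbb{R}^r$ when multiplying $R$). $\operatorname{diag}_B(X)=(X_{ii})_{i\in B}\in\mathbb{R}^{|B|}$ for $X\in\mathbb{R}^{n\times n}$, with adjoint $\operatorname{diag}_B^*(\mu)\in\mathbb{R}^{n\times n}$, the diagonal matrix carrying the entries of $\mu$ at the positions in $B$ and $0$ elsewhere. $R_B$ is the submatrix of rows of $R$ indexed by $B$. For $R\in\mathbb{R}^{n\times r}$, $\widehat R:=\begin{pmatrix}e_1^\top \\ R\end{pmatrix}\in\mathbb{R}^{(n+1)\times r}$. For $X\in\mathbb{S}^{n+1}$, write $X=\begin{pmatrix}X_{11}&X_{12} \\ X_{21}&X_{22}\end{pmatrix}$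 with $X_{11}\in\mathbb{R}$, $X_{21}\in\mathbb{R}^{n}$, $X_{22}\in\mathbb{S}^n$. $(\cdot\,;\cdot)$ denotes vertical stacking. Linear operator: $\mathcal{A}:\mathbb{S}^{n+1}\to\mathbb{R}^{m+mn+|B|+1}$, $$\mathcal{A}(Y)=\big(AY_{21};\ \operatorname{vec}(AY_{22}-bY_{12});\ \operatorname{diag}_B(Y_{22})-(Y_{21})_B;\ Y_{11}\big),\quad d=(b;0_{mn};0_{|B|};1),$$ and $\mathcal{A}^*$ is its adjoint. Functions: $\phi(Y)=\langle C,Y\rangle+\frac{\sigma}{2}\|\Pi_{\mathcal P^*}(\sigma^{-1}\widetilde W-Y)\|^2$ and $f_r(R)=\phi(\widehat R\widehat R^\top)$. Sets: $\mathcal{N}_r=\{R\in\mathbb{R}^{n\times r}: ARe_1=b,\ ARR^\top=b(Re_1)^\top,\ \operatorname{diag}_B(RR^\top)=R_Be_1\}$ and $\mathcal{M}_r=\{R\in\mathbb{R}^{n\times r}: AR=be_1^\top,\ \operatorname{diag}_B(RR^\top)=R_Be_1\}$. *)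

theory Defs
  imports "HOL-Analysis.Analysis"
begin

section \<open>Matrices and block structure\<close>

text \<open>
  Dimensions are index types: \<^typ>\<open>real^'n^'m\<close> has \<open>CARD('m)\<close> rows and \<open>CARD('n)\<close> columns.
  The \<open>n + 1\<close> rows of a bordered matrix are indexed by \<^typ>\<open>'n option\<close>, with \<^const>\<open>None\<close> as
  the first index. The space \<open>\<real>\<^bsup>|B|\<^esup>\<close> is identified with the subspace \<open>coord_space B\<close> of those
  vectors of \<open>\<real>\<^bsup>n\<^esup>\<close> that vanish off \<open>B\<close>, which is also meaningful for \<open>B = {}\<close>.
\<close>

definition symmetric_matrices :: "(real^'k^'k) set" where
  "symmetric_matrices = {X. transpose X = X}"

definition psd :: "real^'k^'k \<Rightarrow> bool" where
  "psd X \<longleftrightarrow> X \<in> symmetric_matrices \<and> (\<forall>x. 0 \<le> x \<bullet> (X *v x))"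

text \<open>The inner product of the matrix type is the trace inner product.\<close>

lemma inner_matrix_eq_trace:
  fixes X Y :: "real^'a^'b"
  shows "X \<bullet> Y = trace (X ** transpose Y)"
  by (simp add: inner_vec_def trace_def matrix_matrix_mult_def transpose_def)

definition e1 :: "real^('r::{finite,linorder})" where
  "e1 = axis (Min UNIV) 1"

definition outer :: "real^'a \<Rightarrow> real^'b \<Rightarrow> real^'b^'a" where
  "outer u v = (\<chi> i j. u $ i * v $ j)"

definition vstack :: "real^'k \<Rightarrow> real^'k^'n \<Rightarrow> real^'k^('n option)" where
  "vstack v M = (\<chi> i. case i of None \<Rightarrow> v | Some i' \<Rightarrow> M $ i')"

definition hstack :: "real^'k \<Rightarrow> real^'n^'k \<Rightarrow> real^('n option)^'k" where
  "hstack v M = (\<chi> i j. case j of None \<Rightarrow> v $ i | Some j' \<Rightarrow> M $ i $ j')"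

definition hat ::
    "real^('r::{finite,linorder})^'n \<Rightarrow> real^('r::{finite,linorder})^('n option)" where
  "hat R = vstack e1 R"

type_synonym 'n bordered = "real^('n option)^('n option)"

definition block_matrix ::
    "real \<Rightarrow> real^'n \<Rightarrow> real^'n \<Rightarrow> real^'n^'n \<Rightarrow> ('n::finite) bordered" where
  "block_matrix a u v M =
     (\<chi> i j. case i of
        None \<Rightarrow> (case j of None \<Rightarrow> a | Some j' \<Rightarrow> u $ j')
      | Some i' \<Rightarrow> (case j of None \<Rightarrow> v $ i' | Some j' \<Rightarrow> M $ i' $ j'))"

definition block11 :: "('n::finite) bordered \<Rightarrow> real" where
  "block11 X = X $ None $ None"

definition block12 :: "('n::finite) bordered \<Rightarrow> real^'n" where
  "block12 X = (\<chi> j. X $ None $ Some j)"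

definition block21 :: "('n::finite) bordered \<Rightarrow> real^'n" where
  "block21 X = (\<chi> i. X $ Some i $ None)"

definition block22 :: "('n::finite) bordered \<Rightarrow> real^'n^'n" where
  "block22 X = (\<chi> i j. X $ Some i $ Some j)"

section \<open>Coordinates in an index set\<close>

definition coord_space :: "'n set \<Rightarrow> (real^'n) set" where
  "coord_space B = {v. \<forall>i. i \<notin> B \<longrightarrow> v $ i = 0}"

definition restr :: "'n set \<Rightarrow> real^'n \<Rightarrow> real^'n" where
  "restr B v = (\<chi> i. if i \<in> B then v $ i else 0)"

definition diag_on :: "'n set \<Rightarrow> real^'n^'n \<Rightarrow> real^'n" where
  "diag_on B X = (\<chi> i. if i \<in> B then X $ i $ i else 0)"

definition diag_adj :: "'n set \<Rightarrow> real^'n \<Rightarrow> real^'n^'n" where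
  "diag_adj B \<mu> = (\<chi> i j. if i = j \<and> i \<in> B then \<mu> $ i else 0)"

text \<open>Since \<open>R\<^sub>B e\<^sub>1 = (R e\<^sub>1)\<^sub>B\<close>, the vector \<open>R\<^sub>B e\<^sub>1\<close> is written \<open>restr B (R *v e1)\<close> below.\<close>

section \<open>The linear operator and its adjoint\<close>

text \<open>
  The stacked space \<open>\<real>\<^bsup>m + mn + |B| + 1\<^esup>\<close> is the product of its four parts; the inner product of
  the product type is the sum of those of the parts, and \<open>vec\<close> is an isometry, so it is dropped.
\<close>

type_synonym ('n, 'm) stacked = "(real^'m) \<times> (real^'n^'m) \<times> (real^'n) \<times> real"

definition constr_op ::
    "real^'n^'m \<Rightarrow> real^'m \<Rightarrow> 'n set \<Rightarrow> ('n::finite) bordered \<Rightarrow> ('n::finite, 'm::finite) stacked" where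
  "constr_op A b B Y =
     (A *v block21 Y,
      A ** block22 Y - outer b (block12 Y),
      diag_on B (block22 Y) - restr B (block21 Y),
      block11 Y)"

definition constr_rhs :: "real^'m \<Rightarrow> ('n::finite, 'm::finite) stacked" where
  "constr_rhs b = (b, 0, 0, 1)"

text \<open>
  The adjoint is taken with respect to the space of symmetric matrices, not the space of all
  square matrices: its values are symmetric.
\<close>

definition sym_adjoint :: "(real^'k^'k \<Rightarrow> 'a::real_inner) \<Rightarrow> 'a \<Rightarrow> real^'k^'k" where
  "sym_adjoint f y =
     (THE X. X \<in> symmetric_matrices \<and> (\<forall>Y\<in>symmetric_matrices. f Y \<bullet> y = Y \<bullet> X))"

lemma inner_transpose_matrix:
  fixes X Y :: "real^'a^'b"
  shows "transpose X \<bullet> transpose Y = X \<bullet> Y"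
  by (simp add: inner_vec_def transpose_def) (rule sum.swap)

lemma sym_adjoint_works:
  fixes f :: "real^'k^'k \<Rightarrow> 'a::euclidean_space"
  assumes "linear f"
  shows "sym_adjoint f y \<in> symmetric_matrices"
    and "Y \<in> symmetric_matrices \<Longrightarrow> f Y \<bullet> y = Y \<bullet> sym_adjoint f y"
proof -
  let ?P = "\<lambda>X. X \<in> symmetric_matrices \<and> (\<forall>Y\<in>symmetric_matrices. f Y \<bullet> y = Y \<bullet> X)"
  define X where "X = (1/2) *\<^sub>R (adjoint f y + transpose (adjoint f y))"
  have ex: "?P X"
  proof (intro conjI ballI)
    show "X \<in> symmetric_matrices"
      by (simp add: X_def symmetric_matrices_def transpose_def vec_eq_iff)
    fix Y :: "real^'k^'k" assume "Y \<in> symmetric_matrices"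
    then have "Y \<bullet> transpose (adjoint f y) = Y \<bullet> adjoint f y"
      using inner_transpose_matrix[of Y "adjoint f y"] by (simp add: symmetric_matrices_def)
    then show "f Y \<bullet> y = Y \<bullet> X"
      by (simp add: X_def inner_add_right adjoint_works[OF assms])
  qed
  have "X' = X" if "?P X'" for X'
  proof -
    have D: "X' - X \<in> symmetric_matrices"
      using that ex by (simp add: symmetric_matrices_def transpose_def vec_eq_iff)
    then have "(X' - X) \<bullet> X' = (X' - X) \<bullet> X"
      using that ex by metis
    then have "(X' - X) \<bullet> (X' - X) = 0"
      by (simp add: inner_diff_right)
    then show ?thesis by simp
  qed
  then have "?P (sym_adjoint f y)"
    unfolding sym_adjoint_def by (rule theI[of ?P, OF ex])
  then show "sym_adjoint f y \<in> symmetric_matrices"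
    and "Y \<in> symmetric_matrices \<Longrightarrow> f Y \<bullet> y = Y \<bullet> sym_adjoint f y"
    by auto
qed

lemma linear_constr_op: "linear (constr_op A b B)"
  by (rule linearI)
    (simp_all add: constr_op_def vec_eq_iff block11_def block12_def block21_def block22_def
      matrix_vector_mult_def matrix_matrix_mult_def outer_def diag_on_def restr_def
      algebra_simps sum.distrib sum_distrib_left)

section \<open>Dual cone, objective functions and constraint residuals\<close>

definition dual_cone :: "(real^'k^'k) set \<Rightarrow> (real^'k^'k) set" where
  "dual_cone P = {X \<in> symmetric_matrices. \<forall>Y\<in>P. 0 \<le> X \<bullet> Y}"

definition objective_phi ::
    "real^'k^'k \<Rightarrow> (real^'k^'k) set \<Rightarrow> real \<Rightarrow> real^'k^'k \<Rightarrow> real^'k^'k \<Rightarrow> real" where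
  "objective_phi C P \<sigma> Wt Y =
     C \<bullet> Y + \<sigma> / 2 * (norm (closest_point (dual_cone P) ((1 / \<sigma>) *\<^sub>R Wt - Y)))\<^sup>2"

definition objective_f ::
    "('n::finite) bordered \<Rightarrow> ('n::finite) bordered set \<Rightarrow> real \<Rightarrow>
     ('n::finite) bordered \<Rightarrow> real^('r::{finite,linorder})^'n \<Rightarrow> real" where
  "objective_f C P \<sigma> Wt R = objective_phi C P \<sigma> Wt (hat R ** transpose (hat R))"

definition residual_M ::
    "real^'n^'m \<Rightarrow> real^'m \<Rightarrow> 'n set \<Rightarrow> real^('r::{finite,linorder})^'n \<Rightarrow>
     (real^('r::{finite,linorder})^'m) \<times> (real^'n)" where
  "residual_M A b B R =
     (A ** R - outer b e1, diag_on B (R ** transpose R) - restr B (R *v e1))"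

definition residual_N ::
    "real^'n^'m \<Rightarrow> real^'m \<Rightarrow> 'n set \<Rightarrow> real^('r::{finite,linorder})^'n \<Rightarrow>
     (real^'m) \<times> (real^'n^'m) \<times> (real^'n)" where
  "residual_N A b B R =
     (A *v (R *v e1) - b,
      A ** (R ** transpose R) - outer b (R *v e1),
      diag_on B (R ** transpose R) - restr B (R *v e1))"

text \<open>
  KKT conditions of \<open>min {f x | g x = 0}\<close> with multiplier \<open>y\<close>: feasibility, and stationarity of
  the Lagrangian. The lemmas \<open>kkt_M_iff\<close> and \<open>kkt_N_iff\<close> below show that for the two factorized
  problems they amount to explicit matrix equations.
\<close>

definition kkt_eq :: "('a::real_normed_vector \<Rightarrow> real) \<Rightarrow> ('a \<Rightarrow> 'b::real_inner) \<Rightarrow> 'a \<Rightarrow> 'b \<Rightarrow> bool"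
  where "kkt_eq f g x y \<longleftrightarrow> g x = 0 \<and> ((\<lambda>x. f x - g x \<bullet> y) has_derivative (\<lambda>_. 0)) (at x)"

section \<open>Gradients and Lagrangians\<close>

lemma projection_sq_has_derivative:
  fixes K :: "'a::euclidean_space set"
  assumes K: "closed K" "convex_cone K"
  shows "((\<lambda>x. (norm (closest_point K x))\<^sup>2) has_derivative (\<lambda>h. 2 * (closest_point K x \<bullet> h))) (at x)"
proof -
  define p where "p = closest_point K"
  have cv: "convex K" and cn: "conic K" and ne: "K \<noteq> {}"
    using K(2) by (auto simp: convex_cone_def)
  have pK: "p z \<in> K" for z
    unfolding p_def using closest_point_in_set[OF K(1) ne] .
  have dot: "(z - p z) \<bullet> (k - p z) \<le> 0" if "k \<in> K" for z k
    unfolding p_def using closest_point_dot[OF cv K(1) that] .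
  have eq: "z \<bullet> p z = p z \<bullet> p z" for z
  proof -
    have "0 \<in> K" using conicD[OF cn pK, of 0 z] by simp
    moreover have "2 *\<^sub>R p z \<in> K" using conicD[OF cn pK, of 2 z] by simp
    ultimately show ?thesis
      using dot[of 0 z] dot[of "2 *\<^sub>R p z" z]
      by (simp add: inner_diff_left inner_diff_right)
  qed
  have ge: "2 * (z \<bullet> k) - k \<bullet> k \<le> p z \<bullet> p z" if "k \<in> K" for z k
  proof -
    have "z \<bullet> k \<le> p z \<bullet> k"
      using dot[OF that, of z] eq[of z] by (simp add: inner_diff_left inner_diff_right inner_commute)
    moreover have "0 \<le> (p z - k) \<bullet> (p z - k)" by simp
    ultimately show ?thesis
      by (simp add: inner_diff_left inner_diff_right inner_commute)
  qed
  have bound: "\<bar>p (x + h) \<bullet> p (x + h) - p x \<bullet> p x - 2 * (p x \<bullet> h)\<bar> \<le> 2 * (norm h * norm h)" for h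
  proof -
    have lo: "0 \<le> p (x + h) \<bullet> p (x + h) - p x \<bullet> p x - 2 * (p x \<bullet> h)"
      using ge[OF pK[of x], of "x + h"] eq[of x]
      by (simp add: inner_add_left inner_commute[of h "p x"])
    have "p (x + h) \<bullet> p (x + h) - p x \<bullet> p x - 2 * (p x \<bullet> h) \<le> 2 * ((p (x + h) - p x) \<bullet> h)"
      using ge[OF pK[of "x + h"], of x] eq[of "x + h"]
      by (simp add: inner_add_left inner_diff_left inner_commute[of h "p (x + h)"])
    also have "(p (x + h) - p x) \<bullet> h \<le> norm (p (x + h) - p x) * norm h"
      by (rule norm_cauchy_schwarz)
    also have "norm (p (x + h) - p x) \<le> norm h"
      using closest_point_lipschitz[OF cv K(1) ne, of "x + h" x]
      by (simp add: p_def dist_norm)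
    finally show ?thesis
      using lo by (simp add: mult_right_mono)
  qed
  have "((\<lambda>h. norm (p (x + h) \<bullet> p (x + h) - p x \<bullet> p x - 2 * (p x \<bullet> h)) / norm h) \<longlongrightarrow> 0) (at 0)"
  proof (rule Lim_null_comparison)
    show "\<forall>\<^sub>F h in at 0. norm (norm (p (x + h) \<bullet> p (x + h) - p x \<bullet> p x - 2 * (p x \<bullet> h)) / norm h)
            \<le> 2 * norm h"
      using bound by (auto simp: eventually_at_filter divide_simps mult.assoc)
    show "((\<lambda>h::'a. 2 * norm h) \<longlongrightarrow> 0) (at 0)"
      by (auto intro!: tendsto_eq_intros)
  qed
  moreover have "bounded_linear (\<lambda>h. 2 * (p x \<bullet> h))"
    by (intro bounded_linear_intros)
  ultimately have "((\<lambda>x. p x \<bullet> p x) has_derivative (\<lambda>h. 2 * (p x \<bullet> h))) (at x)"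
    by (simp add: has_derivative_at)
  then show ?thesis
    by (simp add: p_def power2_norm_eq_inner)
qed

lemma bounded_linear_transpose: "bounded_linear (transpose :: real^'a^'b \<Rightarrow> real^'b^'a)"
  unfolding linear_conv_bounded_linear[symmetric]
  by (rule linearI) (simp_all add: transpose_def vec_eq_iff)

lemma closed_dual_cone:
  fixes P :: "(real^'k^'k) set"
  shows "closed (dual_cone P)"
proof -
  have "dual_cone P = {X. transpose X = X} \<inter> (\<Inter>Y\<in>P. {X. 0 \<le> X \<bullet> Y})"
    by (auto simp: dual_cone_def symmetric_matrices_def)
  moreover have "closed {X::real^'k^'k. transpose X = X}"
    by (intro closed_Collect_eq linear_continuous_on bounded_linear_transpose bounded_linear_ident)
  moreover have "closed {X::real^'k^'k. 0 \<le> X \<bullet> Y}" for Y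
    by (intro closed_Collect_le continuous_intros)
  ultimately show ?thesis by (simp add: closed_INT closed_Int)
qed

lemma convex_cone_dual_cone: "convex_cone (dual_cone P)"
proof -
  have "0 \<in> dual_cone P"
    by (simp add: dual_cone_def symmetric_matrices_def transpose_def vec_eq_iff)
  moreover have "convex (dual_cone P)"
    by (auto simp: convex_def dual_cone_def symmetric_matrices_def transpose_def vec_eq_iff
        inner_add_left)
  moreover have "conic (dual_cone P)"
    by (auto simp: conic_def dual_cone_def symmetric_matrices_def transpose_def vec_eq_iff)
  ultimately show ?thesis by (auto simp: convex_cone_def)
qed

text \<open>The gradient of \<open>\<phi>\<close> at \<open>Y\<close> is \<open>C - W\<close>.\<close>

lemma objective_phi_has_derivative:
  assumes W: "W = \<sigma> *\<^sub>R closest_point (dual_cone P) ((1 / \<sigma>) *\<^sub>R Wt - Y)"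
  shows "(objective_phi C P \<sigma> Wt has_derivative (\<lambda>H. (C - W) \<bullet> H)) (at Y)"
proof -
  let ?K = "dual_cone P"
  have "((\<lambda>Y. (1 / \<sigma>) *\<^sub>R Wt - Y) has_derivative (\<lambda>H. - H)) (at Y)"
    by (auto intro!: derivative_eq_intros)
  from has_derivative_compose[OF this
      projection_sq_has_derivative[OF closed_dual_cone convex_cone_dual_cone]]
  have "((\<lambda>Y. (norm (closest_point ?K ((1 / \<sigma>) *\<^sub>R Wt - Y)))\<^sup>2) has_derivative
      (\<lambda>H. 2 * (closest_point ?K ((1 / \<sigma>) *\<^sub>R Wt - Y) \<bullet> - H))) (at Y)" .
  from has_derivative_add[OF has_derivative_inner_right[OF has_derivative_ident, of C]
      has_derivative_mult_right[OF this, of "\<sigma> / 2"]]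
  show ?thesis
    by (simp add: objective_phi_def[abs_def] W inner_diff_left)
qed

lemma matrix_inner_mult_right:
  fixes X :: "real^'c^'a" and U :: "real^'b^'a" and V :: "real^'c^'b"
  shows "X \<bullet> (U ** V) = (X ** transpose V) \<bullet> U"
proof -
  have "X \<bullet> (U ** V) = (\<Sum>i\<in>UNIV. \<Sum>j\<in>UNIV. \<Sum>k\<in>UNIV. X $ i $ j * (U $ i $ k * V $ k $ j))"
    by (simp add: inner_vec_def matrix_matrix_mult_def sum_distrib_left)
  also have "\<dots> = (\<Sum>i\<in>UNIV. \<Sum>k\<in>UNIV. \<Sum>j\<in>UNIV. X $ i $ j * (U $ i $ k * V $ k $ j))"
    by (intro sum.cong refl sum.swap)
  also have "\<dots> = (X ** transpose V) \<bullet> U"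
    by (simp add: inner_vec_def matrix_matrix_mult_def transpose_def
        sum_distrib_left mult_ac)
  finally show ?thesis .
qed

lemma matrix_inner_mult_left:
  fixes X :: "real^'c^'a" and U :: "real^'b^'a" and V :: "real^'c^'b"
  shows "X \<bullet> (U ** V) = (transpose U ** X) \<bullet> V"
proof -
  have "X \<bullet> (U ** V) = transpose X \<bullet> (transpose V ** transpose U)"
    by (metis inner_transpose_matrix matrix_transpose_mul)
  also have "\<dots> = (transpose X ** U) \<bullet> transpose V"
    by (simp add: matrix_inner_mult_right)
  also have "\<dots> = (transpose U ** X) \<bullet> V"
    by (metis inner_transpose_matrix matrix_transpose_mul transpose_transpose)
  finally show ?thesis .
qed

lemma bounded_bilinear_matrix_mult:
  "bounded_bilinear ((**) :: real^'b^'a \<Rightarrow> real^'c^'b \<Rightarrow> real^'c^'a)"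
  unfolding bilinear_conv_bounded_bilinear[symmetric] bilinear_def
  by (auto intro!: linearI simp: matrix_matrix_mult_def vec_eq_iff algebra_simps
      sum.distrib sum_distrib_left)

lemma gram_has_derivative:
  fixes U :: "'a::real_normed_vector \<Rightarrow> real^'r^'k"
  assumes "(U has_derivative U') (at x)" and D: "D \<in> symmetric_matrices"
  shows "((\<lambda>x. D \<bullet> (U x ** transpose (U x))) has_derivative (\<lambda>h. 2 * ((D ** U x) \<bullet> U' h))) (at x)"
proof -
  from bounded_linear.has_derivative[OF bounded_linear_transpose assms(1)]
  have "((\<lambda>x. transpose (U x)) has_derivative (\<lambda>h. transpose (U' h))) (at x)" .
  from bounded_bilinear.FDERIV[OF bounded_bilinear_matrix_mult assms(1) this]
  have "((\<lambda>x. U x ** transpose (U x)) has_derivative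
      (\<lambda>h. U x ** transpose (U' h) + U' h ** transpose (U x))) (at x)" .
  from has_derivative_inner_right[OF this, of D]
  have *: "((\<lambda>x. D \<bullet> (U x ** transpose (U x))) has_derivative
      (\<lambda>h. D \<bullet> (U x ** transpose (U' h) + U' h ** transpose (U x)))) (at x)" .
  have "D \<bullet> (U x ** transpose (U' h) + U' h ** transpose (U x)) = 2 * ((D ** U x) \<bullet> U' h)" for h
  proof -
    have "D \<bullet> (U x ** transpose (U' h)) = transpose D \<bullet> (U' h ** transpose (U x))"
      by (metis inner_transpose_matrix matrix_transpose_mul transpose_transpose)
    then show ?thesis
      using D by (simp add: inner_add_right matrix_inner_mult_right symmetric_matrices_def)
  qed
  then show ?thesis using * by simp
qed

lemma has_derivative_hat:
  "(hat has_derivative (\<lambda>H. vstack 0 H)) (at (R :: real^('r::{finite,linorder})^'n))"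
proof -
  have "bounded_linear (vstack 0 :: real^('r::{finite,linorder})^'n \<Rightarrow> real^('r::{finite,linorder})^('n option))"
    unfolding linear_conv_bounded_linear[symmetric]
    by (rule linearI) (simp_all add: vstack_def vec_eq_iff split: option.split)
  moreover have "hat = (\<lambda>R :: real^('r::{finite,linorder})^'n. vstack e1 0 + vstack 0 R)"
    by (simp add: fun_eq_iff hat_def vstack_def vec_eq_iff split: option.split)
  ultimately show ?thesis
    using has_derivative_add[OF has_derivative_const bounded_linear_imp_has_derivative,
        of "vstack 0 :: real^('r::{finite,linorder})^'n \<Rightarrow> _" "vstack e1 0"] by simp
qed

lemma sum_option:
  fixes f :: "'n::finite option \<Rightarrow> 'a::comm_monoid_add"
  shows "sum f UNIV = f None + (\<Sum>i\<in>UNIV. f (Some i))"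
  by (simp add: UNIV_option_conv sum.reindex)

lemma objective_f_has_derivative:
  fixes R :: "real^('r::{finite,linorder})^'n"
  assumes Q: "Q \<in> symmetric_matrices"
    and W: "W = \<sigma> *\<^sub>R closest_point (dual_cone P) ((1 / \<sigma>) *\<^sub>R Wt - hat R ** transpose (hat R))"
  shows "(objective_f (block_matrix 0 c c Q) P \<sigma> Wt has_derivative
     (\<lambda>H. (2 *\<^sub>R ((Q - block22 W) ** R) + outer (2 *\<^sub>R c - 2 *\<^sub>R block21 W) e1) \<bullet> H)) (at R)"
proof -
  let ?C = "block_matrix 0 c c Q"
  let ?D = "?C - W"
  have ne: "dual_cone P \<noteq> {}"
    using convex_cone_dual_cone[of P] by (auto simp: convex_cone_def)
  have "W \<in> symmetric_matrices"
    using closest_point_in_set[OF closed_dual_cone ne]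
    by (auto simp: W dual_cone_def symmetric_matrices_def transpose_def vec_eq_iff)
  then have D: "?D \<in> symmetric_matrices"
    using Q by (auto simp: symmetric_matrices_def transpose_def vec_eq_iff block_matrix_def
        split: option.split)
  have gram: "((\<lambda>R. ?D \<bullet> (hat R ** transpose (hat R))) has_derivative
      (\<lambda>H. 2 * ((?D ** hat R) \<bullet> vstack 0 H))) (at R)"
    by (rule gram_has_derivative[OF has_derivative_hat D])
  have "\<exists>G'. ((\<lambda>R. hat R ** transpose (hat R)) has_derivative G') (at R)"
  proof -
    from bounded_bilinear.FDERIV[OF bounded_bilinear_matrix_mult has_derivative_hat
        bounded_linear.has_derivative[OF bounded_linear_transpose has_derivative_hat]]
    show ?thesis by blast
  qed
  then obtain G' where G': "((\<lambda>R. hat R ** transpose (hat R)) has_derivative G') (at R)" ..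
  have "(\<lambda>H. ?D \<bullet> G' H) = (\<lambda>H. 2 * ((?D ** hat R) \<bullet> vstack 0 H))"
    using has_derivative_unique[OF has_derivative_inner_right[OF G', of ?D] gram] .
  moreover have "((\<lambda>R. objective_phi ?C P \<sigma> Wt (hat R ** transpose (hat R))) has_derivative
      (\<lambda>H. ?D \<bullet> G' H)) (at R)"
    using has_derivative_compose[OF G' objective_phi_has_derivative[OF W]] .
  moreover have "2 * ((?D ** hat R) \<bullet> vstack 0 H) =
      (2 *\<^sub>R ((Q - block22 W) ** R) + outer (2 *\<^sub>R c - 2 *\<^sub>R block21 W) e1) \<bullet> H" for H
  proof -
    have "(?D ** hat R) \<bullet> vstack 0 H =
        ((Q - block22 W) ** R + outer (c - block21 W) e1) \<bullet> H"
      by (simp add: inner_vec_def sum_option vstack_def hat_def matrix_matrix_mult_def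
          block_matrix_def block21_def block22_def outer_def algebra_simps)
    moreover have "outer (2 *\<^sub>R c - 2 *\<^sub>R block21 W) e1 =
        2 *\<^sub>R (outer (c - block21 W) e1 :: real^('r::{finite,linorder})^'n)"
      by (simp add: outer_def vec_eq_iff algebra_simps)
    ultimately show ?thesis
      by (simp add: inner_add_left)
  qed
  ultimately show ?thesis
    by (simp add: objective_f_def[abs_def])
qed

lemma diag_residual_has_derivative:
  fixes R :: "real^('r::{finite,linorder})^'n"
  shows "((\<lambda>R. (diag_on B (R ** transpose R) - restr B (R *v e1)) \<bullet> \<mu>) has_derivative
     (\<lambda>H. (2 *\<^sub>R (diag_adj B \<mu> ** R) - outer (diag_adj B \<mu> *v vec 1) e1) \<bullet> H)) (at R)"
proof -
  let ?D = "diag_adj B \<mu>"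
  have D: "?D \<in> symmetric_matrices"
    by (auto simp: symmetric_matrices_def diag_adj_def transpose_def vec_eq_iff)
  have row: "(\<Sum>j\<in>UNIV. ?D $ i $ j * v j) = (if i \<in> B then \<mu> $ i * v i else 0)" for i v
  proof -
    have "(\<Sum>j\<in>UNIV. ?D $ i $ j * v j) =
        (\<Sum>j\<in>UNIV. if j = i then (if i \<in> B then \<mu> $ i * v i else 0) else 0)"
      by (intro sum.cong) (auto simp: diag_adj_def)
    then show ?thesis by simp
  qed
  have 1: "diag_on B X \<bullet> \<mu> = ?D \<bullet> X" for X
    by (auto simp: inner_vec_def diag_on_def row intro!: sum.cong)
  have 2: "restr B (X *v e1) \<bullet> \<mu> = outer (?D *v vec 1) e1 \<bullet> X"
    for X :: "real^('r::{finite,linorder})^'n"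
  proof -
    have "?D *v vec 1 = restr B \<mu>"
      using row[of _ "\<lambda>_. 1"] by (simp add: matrix_vector_mult_def restr_def vec_eq_iff)
    then show ?thesis
      by (auto simp: inner_vec_def restr_def outer_def matrix_vector_mult_def sum_distrib_left
          mult_ac intro!: sum.cong)
  qed
  have "((\<lambda>R. ?D \<bullet> (R ** transpose R) - outer (?D *v vec 1) e1 \<bullet> R) has_derivative
     (\<lambda>H. 2 * ((?D ** R) \<bullet> H) - outer (?D *v vec 1) e1 \<bullet> H)) (at R)"
    by (intro has_derivative_diff gram_has_derivative[OF has_derivative_ident D]
        has_derivative_inner_right has_derivative_ident)
  then show ?thesis
    by (simp add: inner_diff_left 1 2)
qed

lemma kkt_eq_iff_gradient:
  assumes "((\<lambda>x. f x - g x \<bullet> y) has_derivative (\<lambda>h. G \<bullet> h)) (at x)"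
  shows "kkt_eq f g x y \<longleftrightarrow> g x = 0 \<and> G = (0::'a::real_inner)"
proof -
  have "((\<lambda>x. f x - g x \<bullet> y) has_derivative (\<lambda>_. 0)) (at x) \<longleftrightarrow> G = 0"
  proof
    assume "((\<lambda>x. f x - g x \<bullet> y) has_derivative (\<lambda>_. 0)) (at x)"
    from has_derivative_unique[OF assms this] have "G \<bullet> G = 0" by metis
    then show "G = 0" by simp
  qed (use assms in simp)
  then show ?thesis by (auto simp: kkt_eq_def)
qed

lemma kkt_M_iff:
  fixes R :: "real^('r::{finite,linorder})^'n"
  assumes Q: "Q \<in> symmetric_matrices"
    and W: "W = \<sigma> *\<^sub>R closest_point (dual_cone P) ((1 / \<sigma>) *\<^sub>R Wt - hat R ** transpose (hat R))"
    and L: "L = Q - diag_adj B \<mu> - block22 W"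
    and q: "q = 2 *\<^sub>R c + diag_adj B \<mu> *v vec 1 - 2 *\<^sub>R block21 W"
  shows "kkt_eq (objective_f (block_matrix 0 c c Q) P \<sigma> Wt) (residual_M A b B) R (lam, \<mu>) \<longleftrightarrow>
     2 *\<^sub>R (L ** R) + outer q e1 - transpose A ** lam = 0
     \<and> A ** R = outer b e1
     \<and> diag_on B (R ** transpose R) - restr B (R *v e1) = 0"
proof -
  have 1: "((\<lambda>R. (A ** R - outer b e1) \<bullet> lam) has_derivative (\<lambda>H. (transpose A ** lam) \<bullet> H)) (at R)"
  proof -
    have "(\<lambda>R. (A ** R - outer b e1) \<bullet> lam) = (\<lambda>R. (transpose A ** lam) \<bullet> R - outer b e1 \<bullet> lam)"
      using matrix_inner_mult_left[of lam A]
      by (simp add: fun_eq_iff inner_diff_left inner_diff_right inner_commute)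
    then show ?thesis
      by (auto intro!: derivative_eq_intros)
  qed
  have eq: "2 *\<^sub>R (L ** R) + outer q e1 - transpose A ** lam =
      2 *\<^sub>R ((Q - block22 W) ** R) + outer (2 *\<^sub>R c - 2 *\<^sub>R block21 W) e1
      - (transpose A ** lam + (2 *\<^sub>R (diag_adj B \<mu> ** R) - outer (diag_adj B \<mu> *v vec 1) e1))"
    by (simp add: L q vec_eq_iff outer_def matrix_matrix_mult_def algebra_simps
        sum.distrib sum_subtractf)
  have "((\<lambda>R. objective_f (block_matrix 0 c c Q) P \<sigma> Wt R - residual_M A b B R \<bullet> (lam, \<mu>))
      has_derivative (\<lambda>H. (2 *\<^sub>R (L ** R) + outer q e1 - transpose A ** lam) \<bullet> H)) (at R)"
    using has_derivative_diff[OF objective_f_has_derivative[OF Q W, where c = c]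
        has_derivative_add[OF 1 diag_residual_has_derivative]]
    by (simp add: residual_M_def eq inner_diff_left inner_add_left)
  from kkt_eq_iff_gradient[OF this] show ?thesis
    unfolding residual_M_def[of A b B R] zero_prod_def prod.inject right_minus_eq by metis
qed

lemma inner_outer_left:
  fixes X :: "real^'b^'a"
  shows "outer u v \<bullet> X = u \<bullet> (X *v v)"
  by (simp add: inner_vec_def outer_def matrix_vector_mult_def sum_distrib_left mult_ac)

lemma kkt_N_iff:
  fixes R :: "real^('r::{finite,linorder})^'n"
  assumes Q: "Q \<in> symmetric_matrices"
    and W: "W = \<sigma> *\<^sub>R closest_point (dual_cone P) ((1 / \<sigma>) *\<^sub>R Wt - hat R ** transpose (hat R))"
    and L: "L = Q - diag_adj B \<mu> - block22 W"
    and q: "q = 2 *\<^sub>R c + diag_adj B \<mu> *v vec 1 - 2 *\<^sub>R block21 W"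
  shows "kkt_eq (objective_f (block_matrix 0 c c Q) P \<sigma> Wt) (residual_N A b B) R (lam1, lam2, \<mu>) \<longleftrightarrow>
     2 *\<^sub>R (L ** R) + outer q e1
       - (outer (transpose A *v lam1) e1 + transpose A ** lam2 ** R
          + transpose lam2 ** A ** R - outer (transpose lam2 *v b) e1) = 0
     \<and> A *v (R *v e1) = b
     \<and> A ** R ** transpose R = outer b (R *v e1)
     \<and> diag_on B (R ** transpose R) = restr B (R *v e1)"
proof -
  let ?G1 = "outer (transpose A *v lam1) e1 :: real^('r::{finite,linorder})^'n"
  let ?G2 = "transpose A ** lam2 ** R + transpose lam2 ** A ** R - outer (transpose lam2 *v b) e1"
  let ?D = "(1 / 2) *\<^sub>R (transpose A ** lam2 + transpose lam2 ** A)"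
  have D: "?D \<in> symmetric_matrices"
    by (simp add: symmetric_matrices_def transpose_def matrix_matrix_mult_def vec_eq_iff
        mult.commute add.commute)
  have 1: "((\<lambda>R. (A *v (R *v e1) - b) \<bullet> lam1) has_derivative (\<lambda>H. ?G1 \<bullet> H)) (at R)"
  proof -
    have "(A *v (R *v e1) - b) \<bullet> lam1 = ?G1 \<bullet> R - b \<bullet> lam1"
      for R :: "real^('r::{finite,linorder})^'n"
      by (simp add: inner_diff_right inner_outer_left dot_lmul_matrix inner_commute[of _ lam1])
    then show ?thesis
      by (auto intro!: derivative_eq_intros)
  qed
  have 2: "((\<lambda>R. (A ** (R ** transpose R) - outer b (R *v e1)) \<bullet> lam2) has_derivative
      (\<lambda>H. ?G2 \<bullet> H)) (at R)"
  proof -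
    have "(A ** (R ** transpose R)) \<bullet> lam2 = ?D \<bullet> (R ** transpose R)" for R :: "real^('r::{finite,linorder})^'n"
    proof -
      have "lam2 \<bullet> (A ** (R ** transpose R)) = (transpose A ** lam2) \<bullet> (R ** transpose R)"
        by (rule matrix_inner_mult_left)
      moreover have "(transpose A ** lam2) \<bullet> (R ** transpose R) =
          (transpose lam2 ** A) \<bullet> (R ** transpose R)"
        using inner_transpose_matrix[of "transpose A ** lam2" "R ** transpose R"]
        by (simp add: matrix_transpose_mul)
      ultimately show ?thesis
        by (simp add: inner_add_left inner_commute[of _ lam2])
    qed
    moreover have "outer b (R *v e1) \<bullet> lam2 = outer (transpose lam2 *v b) e1 \<bullet> R" for R :: "real^('r::{finite,linorder})^'n"
      by (simp add: inner_outer_left dot_lmul_matrix)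
    ultimately have "(\<lambda>R :: real^('r::{finite,linorder})^'n. (A ** (R ** transpose R) - outer b (R *v e1)) \<bullet> lam2) =
        (\<lambda>R. ?D \<bullet> (R ** transpose R) - outer (transpose lam2 *v b) e1 \<bullet> R)"
      unfolding inner_diff_left fun_eq_iff by metis
    moreover have "((\<lambda>R. ?D \<bullet> (R ** transpose R) - outer (transpose lam2 *v b) e1 \<bullet> R) has_derivative
        (\<lambda>H. 2 * ((?D ** R) \<bullet> H) - outer (transpose lam2 *v b) e1 \<bullet> H)) (at R)"
      by (intro has_derivative_diff gram_has_derivative[OF has_derivative_ident D]
          has_derivative_inner_right has_derivative_ident)
    moreover have "?G2 = 2 *\<^sub>R (?D ** R) - outer (transpose lam2 *v b) e1"
      by (simp add: bounded_bilinear.add_left[OF bounded_bilinear_matrix_mult]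
          bounded_bilinear.scaleR_left[OF bounded_bilinear_matrix_mult])
    ultimately show ?thesis
      by (simp add: inner_diff_left)
  qed
  have eq: "2 *\<^sub>R (L ** R) + outer q e1 - (?G1 + ?G2) =
      2 *\<^sub>R ((Q - block22 W) ** R) + outer (2 *\<^sub>R c - 2 *\<^sub>R block21 W) e1
      - (?G1 + (?G2 + (2 *\<^sub>R (diag_adj B \<mu> ** R) - outer (diag_adj B \<mu> *v vec 1) e1)))"
    by (simp add: L q vec_eq_iff outer_def matrix_matrix_mult_def algebra_simps
        sum.distrib sum_subtractf)
  have "((\<lambda>R. objective_f (block_matrix 0 c c Q) P \<sigma> Wt R - residual_N A b B R \<bullet> (lam1, lam2, \<mu>))
      has_derivative (\<lambda>H. (2 *\<^sub>R (L ** R) + outer q e1 - (?G1 + ?G2)) \<bullet> H)) (at R)"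
    unfolding eq
    using has_derivative_diff[OF objective_f_has_derivative[OF Q W, where c = c]
        has_derivative_add[OF 1 has_derivative_add[OF 2 diag_residual_has_derivative]]]
    by (simp add: residual_N_def inner_diff_left inner_add_left)
  from kkt_eq_iff_gradient[OF this] show ?thesis
    unfolding residual_N_def[of A b B R] zero_prod_def prod.inject right_minus_eq
      matrix_mul_assoc add.assoc add_diff_eq by metis
qed

end

theory Submission
  imports Defs
begin

text \<open>
  Write \<open>x = R e\<^sub>1\<close> and \<open>M = A\<^sup>\<dagger> A\<close>. Because \<open>A\<close> has full row rank, \<open>A A\<^sup>\<dagger> = I\<close> and \<open>M\<close>
  is the orthogonal projection onto the row space of \<open>A\<close>, so \<open>J = I - M\<close> is the one onto the null
  space. The multipliers \<open>\<lambda>\<^sub>1\<close> and \<open>\<lambda>\<^sub>2\<close> are built so that \<open>A\<^sup>T \<lambda>\<^sub>1\<close> and \<open>A\<^sup>T \<lambda>\<^sub>2\<close> have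
  their columns in the range of \<open>M\<close>, being \<open>M (q + L A\<^sup>\<dagger> b)\<close> and \<open>2 M L - M L M\<close>.

  Stationarity splits along the two projections. Its row space part is what \<open>\<lambda>\<close> absorbs: by
  \<open>M R = A\<^sup>\<dagger> b e\<^sub>1\<^sup>T\<close> the new multiplier terms sum to \<open>M (2 L R + q e\<^sub>1\<^sup>T) = M A\<^sup>T \<lambda> = A\<^sup>T \<lambda>\<close>,
  which is the stationarity condition over \<open>N\<^sub>r\<close> (\<open>lifted_stationarity\<close>). Its null space part
  says \<open>2 J L R = - J q e\<^sub>1\<^sup>T\<close> (\<open>projected_stationarity\<close>), and this does two things.

  \<^item> It determines the border of \<open>S\<close>. With the adjoint in block form (\<open>sym_adjoint_constr_op\<close>), the
    lower right block of \<open>S\<close> is \<open>L - M L - L M + M L M = J L J\<close>, and twice its border column is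
    \<open>J q + 2 J L A\<^sup>\<dagger> b = - 2 J L J x\<close> (\<open>slack_blocks\<close>); \<open>\<alpha>\<close> makes the corner fit. This is the
    claimed factorization.
  \<^item> It gives complementarity. The right factor of \<open>S\<close> maps the factor of \<open>Y\<close> to
    \<open>R - x e\<^sub>1\<^sup>T\<close>, which \<open>J\<close> fixes since \<open>A R = b e\<^sub>1\<^sup>T\<close>, and \<open>J L (R - x e\<^sub>1\<^sup>T) = 0\<close> since
    \<open>J L R\<close> has the form \<open>u e\<^sub>1\<^sup>T\<close> (\<open>slack_annihilates_factor\<close>). Hence \<open>S\<close> kills \<open>Y\<close>.

  The relations between \<open>Z\<close> and \<open>W\<close> are Moreau's decomposition of \<open>Y - (1 / \<sigma>) Wt\<close> with respect
  to the cone \<open>P\<close> and its dual (\<open>moreau_dual_cone\<close>).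
\<close>

section \<open>Matrix algebra\<close>

lemmas matrix_bilinear_simps =
  bounded_bilinear.add_left[OF bounded_bilinear_matrix_mult]
  bounded_bilinear.add_right[OF bounded_bilinear_matrix_mult]
  bounded_bilinear.diff_left[OF bounded_bilinear_matrix_mult]
  bounded_bilinear.diff_right[OF bounded_bilinear_matrix_mult]
  bounded_bilinear.minus_left[OF bounded_bilinear_matrix_mult]
  bounded_bilinear.minus_right[OF bounded_bilinear_matrix_mult]
  bounded_bilinear.scaleR_left[OF bounded_bilinear_matrix_mult]
  bounded_bilinear.scaleR_right[OF bounded_bilinear_matrix_mult]
  bounded_bilinear.zero_left[OF bounded_bilinear_matrix_mult]
  bounded_bilinear.zero_right[OF bounded_bilinear_matrix_mult]

lemmas matrix_vector_bilinear_simps =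
  matrix_vector_right_distrib matrix_vector_mult_diff_distrib matrix_vector_mult_scaleR
  matrix_vector_mult_add_rdistrib matrix_vector_mult_diff_rdistrib scaleR_matrix_vector_assoc[symmetric]

lemma matrix_mult_outer: "M ** outer u v = outer (M *v u) v"
  by (simp add: outer_def matrix_matrix_mult_def matrix_vector_mult_def vec_eq_iff
      sum_distrib_right mult.assoc)

lemma outer_mult_vector: "outer u v *v w = (v \<bullet> w) *\<^sub>R u"
  by (simp add: outer_def matrix_vector_mult_def vec_eq_iff inner_vec_def
      sum_distrib_left mult_ac)

lemma outer_mult_transpose: "outer u v ** transpose M = outer u (M *v v)"
  by (simp add: outer_def matrix_matrix_mult_def matrix_vector_mult_def transpose_def vec_eq_iff
      sum_distrib_left mult_ac)

lemma outer_left_simps: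
  shows outer_add_left: "outer (u + u') v = outer u v + outer u' v"
    and outer_diff_left: "outer (u - u') v = outer u v - outer u' v"
    and outer_scaleR_left: "outer (k *\<^sub>R u) v = k *\<^sub>R outer u v"
    and outer_minus_left: "outer (- u) v = - outer u v"
  by (simp_all add: outer_def vec_eq_iff algebra_simps)

lemma e1_inner_e1 [simp]: "e1 \<bullet> e1 = 1"
  by (simp add: e1_def inner_axis_axis)

lemma transpose_add: "transpose (M + N) = transpose M + (transpose N :: real^'a^'b)"
  by (simp add: transpose_def vec_eq_iff)

lemma transpose_diff: "transpose (M - N) = transpose M - (transpose N :: real^'a^'b)"
  by (simp add: transpose_def vec_eq_iff)

lemma diag_adj_symmetric: "transpose (diag_adj B \<mu>) = diag_adj B \<mu>"
  by (auto simp: diag_adj_def transpose_def vec_eq_iff)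

lemma inner_diag_adj: "M \<bullet> diag_adj B \<mu> = diag_on B M \<bullet> \<mu>"
proof -
  have "(\<Sum>j\<in>UNIV. M $ i $ j * diag_adj B \<mu> $ i $ j) = (if i \<in> B then M $ i $ i * \<mu> $ i else 0)" for i
  proof -
    have "(\<Sum>j\<in>UNIV. M $ i $ j * diag_adj B \<mu> $ i $ j) =
        (\<Sum>j\<in>UNIV. if j = i then (if i \<in> B then M $ i $ i * \<mu> $ i else 0) else 0)"
      by (intro sum.cong) (auto simp: diag_adj_def)
    then show ?thesis by simp
  qed
  then show ?thesis
    by (auto simp: inner_vec_def diag_on_def intro!: sum.cong)
qed

lemma diag_adj_mult_ones: "diag_adj B \<mu> *v vec 1 = restr B \<mu>"
proof -
  have "(\<Sum>j\<in>UNIV. diag_adj B \<mu> $ i $ j) = (if i \<in> B then \<mu> $ i else 0)" for i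
  proof -
    have "(\<Sum>j\<in>UNIV. diag_adj B \<mu> $ i $ j) =
        (\<Sum>j\<in>UNIV. if j = i then (if i \<in> B then \<mu> $ i else 0) else 0)"
      by (intro sum.cong) (auto simp: diag_adj_def)
    then show ?thesis by simp
  qed
  then show ?thesis
    by (simp add: matrix_vector_mult_def restr_def vec_eq_iff)
qed

lemma inner_restr_commute: "restr B v \<bullet> w = v \<bullet> restr B w"
  by (auto simp: inner_vec_def restr_def intro!: sum.cong)

lemma psd_gram:
  fixes U :: "real^'a^'b"
  shows "psd (U ** transpose U)"
proof -
  have "x \<bullet> ((U ** transpose U) *v x) = (transpose U *v x) \<bullet> (transpose U *v x)" for x
    by (simp add: matrix_vector_mul_assoc[symmetric] dot_lmul_matrix del: matrix_vector_mul_assoc)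
  then show ?thesis
    by (simp add: psd_def symmetric_matrices_def matrix_transpose_mul)
qed

section \<open>Bordered matrices\<close>

lemma transpose_vstack: "transpose (vstack v M) = hstack v (transpose M)"
  by (simp add: vstack_def hstack_def transpose_def vec_eq_iff split: option.split)

lemma vstack_mult: "vstack v M ** N = vstack (transpose N *v v) (M ** (N :: real^'a^'b))"
  by (simp add: vstack_def matrix_matrix_mult_def matrix_vector_mult_def transpose_def vec_eq_iff
      mult.commute split: option.split)

lemma vstack_mult_hstack:
  "vstack v M ** hstack w K = block_matrix (v \<bullet> w) (transpose K *v v) (M *v w) (M ** K)"
  by (simp add: vstack_def hstack_def block_matrix_def matrix_matrix_mult_def
      matrix_vector_mult_def transpose_def vec_eq_iff inner_vec_def mult.commute split: option.split)

lemma hstack_mult_vstack: "hstack v M ** vstack w K = outer v w + M ** K"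
  by (simp add: vstack_def hstack_def outer_def matrix_matrix_mult_def vec_eq_iff sum_option)

lemma block_matrix_diff:
  "block_matrix a u v M - block_matrix a' u' v' M' = block_matrix (a - a') (u - u') (v - v') (M - M')"
  by (simp add: block_matrix_def vec_eq_iff split: option.split)

lemma block_simps [simp]:
  "block11 (block_matrix a u v M) = a"
  "block12 (block_matrix a u v M) = u"
  "block21 (block_matrix a u v M) = v"
  "block22 (block_matrix a u v M) = M"
  by (simp_all add: block11_def block12_def block21_def block22_def block_matrix_def vec_eq_iff)

lemma symmetric_block_matrix:
  assumes "transpose M = M"
  shows "block_matrix a v v M \<in> symmetric_matrices"
  using assms
  by (auto simp: symmetric_matrices_def block_matrix_def transpose_def vec_eq_iff split: option.split)

lemma symmetric_block_decomposition:
  assumes "X \<in> symmetric_matrices"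
  shows "X = block_matrix (block11 X) (block21 X) (block21 X) (block22 X)"
    and "block12 X = block21 X"
    and "transpose (block22 X) = block22 X"
  using assms
  by (auto simp: symmetric_matrices_def block_matrix_def block11_def block12_def block21_def
      block22_def transpose_def vec_eq_iff split: option.split)

lemma inner_symmetric_block_matrix:
  assumes "X \<in> symmetric_matrices"
  shows "X \<bullet> block_matrix a v v M = block11 X * a + 2 * (block21 X \<bullet> v) + block22 X \<bullet> M"
proof -
  have "X $ None $ Some i = X $ Some i $ None" for i
    using assms by (auto simp: symmetric_matrices_def transpose_def vec_eq_iff)
  then show ?thesis
    by (simp add: inner_vec_def sum_option block_matrix_def block11_def block21_def block22_def
        sum.distrib sum_distrib_left algebra_simps)
qed

lemma gram_hat:
  "hat R ** transpose (hat R) = block_matrix 1 (R *v e1) (R *v e1) (R ** transpose R)"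
  by (simp add: hat_def transpose_vstack vstack_mult_hstack del: transpose_matrix_vector)

section \<open>The adjoint of the constraint operator\<close>

text \<open>A competitor differs from the adjoint by a symmetric matrix that is orthogonal to itself.\<close>

lemma sym_adjoint_unique:
  fixes f :: "real^'k^'k \<Rightarrow> 'a::euclidean_space"
  assumes "linear f" "X \<in> symmetric_matrices"
    and "\<And>Y. Y \<in> symmetric_matrices \<Longrightarrow> f Y \<bullet> y = Y \<bullet> X"
  shows "sym_adjoint f y = X"
proof -
  let ?D = "sym_adjoint f y - X"
  have "?D \<in> symmetric_matrices"
    using sym_adjoint_works(1)[OF assms(1), of y] assms(2)
    by (simp add: symmetric_matrices_def transpose_diff)
  then have "?D \<bullet> sym_adjoint f y = ?D \<bullet> X"
    using sym_adjoint_works(2)[OF assms(1)] assms(3) by metis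
  then have "?D \<bullet> ?D = 0"
    by (simp add: inner_diff_right)
  then show ?thesis by simp
qed

lemma inner_matrix_vector_left: "(M *v u) \<bullet> w = u \<bullet> (transpose M *v w)"
  for M :: "real^'a^'b"
  by (metis dot_lmul_matrix inner_commute transpose_matrix_vector)

text \<open>
  Two halvings have different sources. An off-diagonal block is counted twice in the inner product
  of symmetric matrices, so the border carries half of the vector that multiplies \<open>Y\<^sub>2\<^sub>1\<close>; and the
  pairing with \<open>A Y\<^sub>2\<^sub>2\<close> sees only the symmetric part of \<open>A\<^sup>T \<lambda>\<^sub>2\<close>.
\<close>

lemma sym_adjoint_constr_op:
  fixes A :: "real^'n^'m"
  shows "sym_adjoint (constr_op A b B) (lam1, lam2, \<mu>, \<alpha>) =
    block_matrix \<alpha>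
      ((1/2) *\<^sub>R (transpose A *v lam1 - transpose lam2 *v b - restr B \<mu>))
      ((1/2) *\<^sub>R (transpose A *v lam1 - transpose lam2 *v b - restr B \<mu>))
      ((1/2) *\<^sub>R (transpose A ** lam2 + transpose lam2 ** A) + diag_adj B \<mu>)"
    (is "_ = block_matrix \<alpha> ?v ?v ?M")
proof (rule sym_adjoint_unique)
  show "linear (constr_op A b B)"
    by (rule linear_constr_op)
  show "block_matrix \<alpha> ?v ?v ?M \<in> symmetric_matrices"
    by (rule symmetric_block_matrix)
      (simp add: transpose_add transpose_scalar matrix_transpose_mul diag_adj_symmetric add.commute)
  fix Y :: "'n bordered" assume Y: "Y \<in> symmetric_matrices"
  note Yblocks = symmetric_block_decomposition[OF Y]
  have "(A ** block22 Y) \<bullet> lam2 = block22 Y \<bullet> (transpose A ** lam2)"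
    using matrix_inner_mult_left[of lam2 A "block22 Y"] by (simp add: inner_commute)
  moreover have "block22 Y \<bullet> (transpose lam2 ** A) = block22 Y \<bullet> (transpose A ** lam2)"
    using inner_transpose_matrix[of "block22 Y" "transpose lam2 ** A"] Yblocks(3)
    by (simp add: matrix_transpose_mul)
  ultimately have 1: "(A ** block22 Y) \<bullet> lam2 =
      block22 Y \<bullet> ((1/2) *\<^sub>R (transpose A ** lam2 + transpose lam2 ** A))"
    by (simp add: inner_add_right)
  have 2: "outer b (block12 Y) \<bullet> lam2 = block21 Y \<bullet> (transpose lam2 *v b)"
    by (simp add: inner_outer_left Yblocks(2) inner_commute[of b] inner_matrix_vector_left
        del: transpose_matrix_vector)
  show "constr_op A b B Y \<bullet> (lam1, lam2, \<mu>, \<alpha>) = Y \<bullet> block_matrix \<alpha> ?v ?v ?M"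
    by (simp add: constr_op_def inner_symmetric_block_matrix[OF Y] inner_diff_left inner_diff_right
        inner_add_right 1 2 inner_matrix_vector_left[of A] inner_restr_commute inner_diag_adj
        del: transpose_matrix_vector)
qed

section \<open>The pseudoinverse of a matrix with full row rank\<close>

text \<open>The Gram matrix has the kernel of \<open>A\<^sup>T\<close>, because \<open>x\<^sup>T A A\<^sup>T x\<close> is the squared norm of \<open>A\<^sup>T x\<close>.\<close>

lemma invertible_gram_of_full_row_rank:
  fixes A :: "real^'n^'m"
  assumes "rank A = CARD('m)"
  shows "invertible (A ** transpose A)"
proof -
  have inj: "inj ((*v) (transpose A))"
    using assms full_rank_injective[of "transpose A"] by (simp add: rank_transpose)
  have "x = 0" if "(A ** transpose A) *v x = 0" for x
  proof -
    have "(transpose A *v x) \<bullet> (transpose A *v x) = x \<bullet> ((A ** transpose A) *v x)"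
      by (metis inner_matrix_vector_left matrix_vector_mul_assoc transpose_transpose)
    then have "transpose A *v x = transpose A *v 0"
      using that by simp
    then show ?thesis
      using inj by (rule injD[rotated])
  qed
  then show ?thesis
    by (simp add: invertible_left_inverse matrix_left_invertible_ker)
qed

lemma matrix_inv_works:
  fixes M :: "real^'a^'a"
  assumes "invertible M"
  shows "M ** matrix_inv M = mat 1" "matrix_inv M ** M = mat 1"
  using someI_ex[OF assms[unfolded invertible_def]] by (auto simp: matrix_inv_def)

text \<open>Together the two properties make \<open>A\<^sup>\<dagger> A\<close> an orthogonal projection fixing \<open>A\<^sup>T\<close>.\<close>

lemma full_row_rank_pseudoinverse:
  fixes A :: "real^'n^'m"
  assumes "rank A = CARD('m)" and Ad: "Ad = transpose A ** matrix_inv (A ** transpose A)"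
  shows "A ** Ad = mat 1" and "transpose (Ad ** A) = Ad ** A"
proof -
  let ?G = "A ** transpose A"
  note inv = matrix_inv_works[OF invertible_gram_of_full_row_rank[OF assms(1)]]
  show "A ** Ad = mat 1"
    using inv(1) by (simp add: Ad matrix_mul_assoc)
  have "transpose (matrix_inv ?G) ** ?G = mat 1"
    using arg_cong[OF inv(1), of transpose] by (simp add: matrix_transpose_mul)
  then have "transpose (matrix_inv ?G) = matrix_inv ?G"
    using inv(1) by (metis matrix_mul_assoc matrix_mul_lid matrix_mul_rid)
  then show "transpose (Ad ** A) = Ad ** A"
    by (simp add: Ad matrix_transpose_mul matrix_mul_assoc)
qed

section \<open>Projection onto a cone and its dual\<close>

text \<open>
  The projection inequality holds at every point of the cone; at the multiples \<open>0\<close> and \<open>2 p\<close> of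
  the projection \<open>p\<close> itself it gives opposite signs, which forces orthogonality.
\<close>

lemma closest_point_cone_orthogonal:
  fixes K :: "'a::euclidean_space set"
  assumes "closed K" "convex_cone K"
  shows "(z - closest_point K z) \<bullet> closest_point K z = 0"
    and "k \<in> K \<Longrightarrow> (z - closest_point K z) \<bullet> k \<le> 0"
proof -
  let ?p = "closest_point K z"
  have cv: "convex K" and cn: "conic K" and ne: "K \<noteq> {}"
    using assms(2) by (auto simp: convex_cone_def)
  have p: "?p \<in> K"
    using closest_point_in_set[OF assms(1) ne] .
  have dot: "(z - ?p) \<bullet> (k - ?p) \<le> 0" if "k \<in> K" for k
    using closest_point_dot[OF cv assms(1) that] .
  show 0: "(z - ?p) \<bullet> ?p = 0"
    using dot[OF conicD[OF cn p, of 0]] dot[OF conicD[OF cn p, of 2]]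
    by (simp add: inner_diff_right)
  show "(z - ?p) \<bullet> k \<le> 0" if "k \<in> K"
    using dot[OF that] 0 by (simp add: inner_diff_right)
qed

text \<open>
  Moreau's decomposition, in the space of symmetric matrices. The residual lies in the dual cone by
  the projection inequality for \<open>P\<close>; it is the nearest dual point because its distance to \<open>- U\<close>
  is the norm of \<open>Z\<close>, and \<open>|Z|\<^sup>2 = \<langle>Z, U\<rangle> \<le> \<langle>Z, U + X\<rangle>\<close> for every dual \<open>X\<close>.
\<close>

lemma moreau_dual_cone:
  fixes P :: "(real^'k^'k) set"
  assumes P: "closed P" "convex_cone P" "P \<subseteq> symmetric_matrices"
    and U: "U \<in> symmetric_matrices"
  shows "closest_point (dual_cone P) (- U) = closest_point P U - U"
proof (rule sym, rule closest_point_unique)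
  let ?Z = "closest_point P U"
  note proj = closest_point_cone_orthogonal[OF P(1,2), where z = U]
  have Z: "?Z \<in> P"
    using closest_point_in_set[OF P(1)] P(2) by (auto simp: convex_cone_def)
  show "convex (dual_cone P)"
    using convex_cone_dual_cone[of P] by (auto simp: convex_cone_def)
  show "closed (dual_cone P)"
    by (rule closed_dual_cone)
  show "?Z - U \<in> dual_cone P"
    using proj(2) Z P(3) U
    by (auto simp: dual_cone_def symmetric_matrices_def transpose_diff inner_diff_left)
  show "\<forall>X\<in>dual_cone P. dist (- U) (?Z - U) \<le> dist (- U) X"
  proof
    fix X assume "X \<in> dual_cone P"
    then have "0 \<le> X \<bullet> ?Z"
      using Z by (simp add: dual_cone_def)
    have "(norm ?Z)\<^sup>2 = ?Z \<bullet> U"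
      using proj(1) by (simp add: power2_norm_eq_inner inner_diff_left inner_diff_right inner_commute)
    also have "\<dots> \<le> ?Z \<bullet> (U + X)"
      using \<open>0 \<le> X \<bullet> ?Z\<close> by (simp add: inner_add_right inner_commute)
    also have "\<dots> \<le> norm ?Z * norm (U + X)"
      by (rule norm_cauchy_schwarz)
    finally have "norm ?Z \<le> norm (U + X)"
      by (cases "?Z = 0") (simp_all add: power2_eq_square)
    then show "dist (- U) (?Z - U) \<le> dist (- U) X"
      by (simp add: dist_norm norm_minus_commute[of "- U" X])
        (simp add: add.commute)
  qed
qed

section \<open>Multipliers for the lifted problems\<close>

text \<open>
  Multiplying by \<open>J\<close> removes \<open>\<lambda>\<close>. The second equation is the first column of the first; through
  it \<open>J q\<close> is eliminated from the border of the dual slack.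
\<close>

lemma projected_stationarity:
  fixes R :: "real^('r::{finite,linorder})^'n"
  assumes stat: "2 *\<^sub>R (L ** R) + outer q e1 = transpose A ** lam"
    and J: "J ** transpose A = 0"
  shows "2 *\<^sub>R (J ** L ** R) = - outer (J *v q) e1"
    and "2 *\<^sub>R (J *v (L *v (R *v e1))) = - (J *v q)"
proof -
  have "J ** (2 *\<^sub>R (L ** R) + outer q e1) = 0"
    by (simp add: stat matrix_mul_assoc J matrix_bilinear_simps)
  then show *: "2 *\<^sub>R (J ** L ** R) = - outer (J *v q) e1"
    by (simp add: matrix_bilinear_simps matrix_mul_assoc matrix_mult_outer eq_neg_iff_add_eq_0)
  show "2 *\<^sub>R (J *v (L *v (R *v e1))) = - (J *v q)"
    using arg_cong[OF *, of "\<lambda>M. M *v e1"]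
    by (simp add: matrix_vector_bilinear_simps outer_minus_left[symmetric] outer_mult_vector
        matrix_vector_mul_assoc matrix_mul_assoc)
qed

text \<open>
  With \<open>x = R e\<^sub>1\<close>, both assumptions say that a matrix has the form \<open>u e\<^sub>1\<^sup>T\<close>: \<open>R - J R\<close> in
  the first, \<open>J L R\<close> in the second. Right multiplication by \<open>I - e\<^sub>1 e\<^sub>1\<^sup>T\<close>, which turns \<open>R\<close>
  into \<open>R - x e\<^sub>1\<^sup>T\<close>, kills such matrices.
\<close>

lemma slack_annihilates_factor:
  fixes R :: "real^('r::{finite,linorder})^'n"
  assumes JR: "J ** R = R - outer s e1"
    and proj: "2 *\<^sub>R (J ** L ** R) = - outer (J *v q) e1"
  shows "vstack (- (R *v e1)) (mat 1) ** (J ** L ** J) ** hstack (- (R *v e1)) (mat 1) ** hat R = 0"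
proof -
  let ?x = "R *v e1"
  have "J *v ?x = ?x - s"
    using arg_cong[OF JR, of "\<lambda>M. M *v e1"]
    by (simp add: matrix_vector_bilinear_simps outer_mult_vector matrix_vector_mul_assoc)
  then have "J ** (R - outer ?x e1) = R - outer ?x e1"
    by (simp add: matrix_bilinear_simps matrix_mult_outer JR outer_left_simps)
  moreover have "J ** L ** (R - outer ?x e1) = 0"
  proof -
    have "2 *\<^sub>R ((J ** L) *v ?x) = - (J *v q)"
      using arg_cong[OF proj, of "\<lambda>M. M *v e1"]
      by (simp add: matrix_vector_bilinear_simps outer_minus_left[symmetric] outer_mult_vector
          matrix_vector_mul_assoc)
    then have "2 *\<^sub>R (J ** L ** (R - outer ?x e1)) = 0"
      using proj
      by (simp add: matrix_bilinear_simps matrix_mult_outer scaleR_diff_right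
          outer_scaleR_left[symmetric] outer_minus_left)
    then show ?thesis by simp
  qed
  ultimately have "J ** L ** J ** (R - outer ?x e1) = 0"
    by (simp add: matrix_mul_assoc[symmetric])
  moreover have "hstack (- ?x) (mat 1) ** hat R = R - outer ?x e1"
    by (simp add: hat_def hstack_mult_vstack outer_left_simps)
  ultimately show ?thesis
    by (metis matrix_mul_assoc bounded_bilinear.zero_right[OF bounded_bilinear_matrix_mult])
qed

text \<open>
  The two terms in \<open>\<lambda>\<^sub>2\<^sup>T\<close> cancel by \<open>A R = b e\<^sub>1\<^sup>T\<close>. In the others, the correction
  \<open>- A\<^sup>\<dagger> A\<close> inside \<open>\<lambda>\<^sub>2\<close> cancels the summand \<open>L A\<^sup>\<dagger> b\<close> of \<open>\<lambda>\<^sub>1\<close>, which leaves the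
  projection of \<open>2 L R + q e\<^sub>1\<^sup>T = A\<^sup>T \<lambda>\<close> onto the row space of \<open>A\<close>, hence that matrix itself.
\<close>

lemma lifted_stationarity:
  fixes R :: "real^('r::{finite,linorder})^'n" and A :: "real^'n^'m"
  assumes stat: "2 *\<^sub>R (L ** R) + outer q e1 = transpose A ** lam"
    and AR: "A ** R = outer b e1"
    and right_inv: "A ** Ad = mat 1" and sym: "transpose (Ad ** A) = Ad ** A"
    and lam1: "lam1 = transpose Ad *v (q + L *v (Ad *v b))"
    and lam2: "lam2 = transpose Ad ** L ** (2 *\<^sub>R mat 1 - Ad ** A)"
  shows "outer (transpose A *v lam1) e1 + transpose A ** lam2 ** R
           + transpose lam2 ** A ** R - outer (transpose lam2 *v b) e1
         = 2 *\<^sub>R (L ** R) + outer q e1"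
proof -
  let ?M = "Ad ** A"
  have AtAd: "transpose A ** transpose Ad = ?M"
    using sym by (simp add: matrix_transpose_mul)
  have MR: "?M ** R = outer (Ad *v b) e1"
    by (simp add: matrix_mul_assoc[symmetric] AR matrix_mult_outer)
  have "transpose A *v lam1 = ?M *v (q + L *v (Ad *v b))"
    by (simp only: lam1 matrix_vector_mul_assoc AtAd)
  moreover have "transpose A ** lam2 ** R = ?M ** L ** (2 *\<^sub>R R - outer (Ad *v b) e1)"
  proof -
    have "transpose A ** lam2 ** R = ?M ** L ** ((2 *\<^sub>R mat 1 - ?M) ** R)"
      by (simp add: lam2 matrix_mul_assoc AtAd)
    then show ?thesis
      by (simp add: matrix_bilinear_simps MR)
  qed
  moreover have "transpose lam2 ** A ** R = outer (transpose lam2 *v b) e1"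
    by (simp add: matrix_mul_assoc[symmetric] AR matrix_mult_outer)
  ultimately have "outer (transpose A *v lam1) e1 + transpose A ** lam2 ** R
           + transpose lam2 ** A ** R - outer (transpose lam2 *v b) e1
         = ?M ** (2 *\<^sub>R (L ** R) + outer q e1)"
    by (simp add: matrix_bilinear_simps matrix_mult_outer outer_left_simps matrix_mul_assoc
        matrix_vector_bilinear_simps matrix_vector_mul_assoc)
  also have "\<dots> = transpose A ** lam"
  proof -
    have "?M ** transpose A = transpose A"
      by (metis matrix_mul_assoc matrix_mul_lid matrix_transpose_mul right_inv sym)
    then show ?thesis
      by (simp add: stat matrix_mul_assoc)
  qed
  finally show ?thesis
    using stat by simp
qed

text \<open>
  The blocks of the dual slack: the left-hand sides are its lower right block and twice its
  border column. The factor \<open>2 I - A\<^sup>\<dagger> A\<close> in \<open>\<lambda>\<^sub>2\<close> is what makes the symmetric part of \<open>A\<^sup>T \<lambda>\<^sub>2\<close>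
  equal to \<open>L - J L J\<close>.
\<close>

lemma slack_blocks:
  fixes x :: "real^'n" and A :: "real^'n^'m"
  assumes L_sym: "transpose L = L"
    and M_sym: "transpose (Ad ** A) = Ad ** A"
    and J: "J = mat 1 - Ad ** A"
    and Jx: "J *v x = x - Ad *v b"
    and stat: "2 *\<^sub>R (J *v (L *v x)) = - (J *v q)"
    and lam1: "lam1 = transpose Ad *v (q + L *v (Ad *v b))"
    and lam2: "lam2 = transpose Ad ** L ** (2 *\<^sub>R mat 1 - Ad ** A)"
  shows "L - (1/2) *\<^sub>R (transpose A ** lam2 + transpose lam2 ** A) = J ** L ** J"
    and "q - transpose A *v lam1 + transpose lam2 *v b = - 2 *\<^sub>R ((J ** L ** J) *v x)"
proof -
  let ?M = "Ad ** A"
  have AtAd: "transpose A ** transpose Ad = ?M"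
    using M_sym by (simp add: matrix_transpose_mul)
  have lam2T: "transpose lam2 = (2 *\<^sub>R mat 1 - ?M) ** L ** Ad"
    by (simp add: lam2 matrix_transpose_mul[of _ "2 *\<^sub>R mat 1 - ?M"]
        matrix_transpose_mul[of "transpose Ad"] transpose_diff transpose_scalar M_sym L_sym
        matrix_mul_assoc)
  have *: "transpose A ** lam2 = 2 *\<^sub>R (?M ** L) - ?M ** L ** ?M"
  proof -
    have "transpose A ** lam2 = ?M ** L ** (2 *\<^sub>R mat 1 - ?M)"
      by (simp add: lam2 matrix_mul_assoc AtAd)
    then show ?thesis
      by (simp add: matrix_bilinear_simps)
  qed
  have **: "transpose lam2 ** A = 2 *\<^sub>R (L ** ?M) - ?M ** L ** ?M"
    by (simp add: lam2T matrix_bilinear_simps matrix_mul_assoc)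
  have "transpose A ** lam2 + transpose lam2 ** A = 2 *\<^sub>R (?M ** L + L ** ?M - ?M ** L ** ?M)"
    unfolding * ** by (simp add: algebra_simps scaleR_2)
  then show "L - (1/2) *\<^sub>R (transpose A ** lam2 + transpose lam2 ** A) = J ** L ** J"
    by (simp add: J matrix_bilinear_simps matrix_mul_assoc)
  have "transpose A *v lam1 = ?M *v (q + L *v (Ad *v b))"
    by (simp only: lam1 matrix_vector_mul_assoc AtAd)
  moreover have "transpose lam2 *v b = 2 *\<^sub>R (L *v (Ad *v b)) - ?M *v (L *v (Ad *v b))"
    by (simp add: lam2T matrix_bilinear_simps matrix_vector_bilinear_simps matrix_vector_mul_assoc
        matrix_mul_assoc del: transpose_matrix_vector)
  ultimately have "q - transpose A *v lam1 + transpose lam2 *v b =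
      J *v q + 2 *\<^sub>R (J *v (L *v (Ad *v b)))"
    by (simp add: J matrix_vector_bilinear_simps algebra_simps scaleR_2)
  also have "\<dots> = - 2 *\<^sub>R (J *v (L *v (J *v x)))"
  proof -
    have "J *v q = - 2 *\<^sub>R (J *v (L *v x))"
      using stat by (simp add: minus_equation_iff[of _ "J *v q"])
    then show ?thesis
      by (simp add: Jx matrix_vector_bilinear_simps algebra_simps)
  qed
  finally show "q - transpose A *v lam1 + transpose lam2 *v b = - 2 *\<^sub>R ((J ** L ** J) *v x)"
    by (simp add: matrix_vector_mul_assoc matrix_mul_assoc)
qed

theorem theorem1:
  fixes Q :: "real^'n^'n" and c :: "real^'n" and A :: "real^'n^'m" and b :: "real^'m"
    and B :: "'n set" and P :: "(real^('n option)^('n option)) set"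
    and \<sigma> :: real and Wt :: "real^('n option)^('n option)"
    and R :: "real^('r::{finite,linorder})^'n" and lam :: "real^('r::{finite,linorder})^'m" and \<mu> :: "real^'n"
  assumes Q_sym: "Q \<in> symmetric_matrices"
    and A_rank: "rank A = CARD('m)"
    and b_nonneg: "\<forall>i. 0 \<le> b $ i"
    and C_def: "C = block_matrix 0 c c Q"
    and P_sub: "P \<subseteq> symmetric_matrices"
    and P_cone: "convex_cone P"
    and P_poly: "polyhedron P"
    and sigma_pos: "0 < \<sigma>"
    and Wt_sym: "Wt \<in> symmetric_matrices"
    and mu_B: "\<mu> \<in> coord_space B"
    and Y_def: "Y = hat R ** transpose (hat R)"
    and Z_def: "Z = closest_point P (Y - (1 / \<sigma>) *\<^sub>R Wt)"
    and W_def: "W = \<sigma> *\<^sub>R closest_point (dual_cone P) ((1 / \<sigma>) *\<^sub>R Wt - Y)"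
    and L_def: "L = Q - diag_adj B \<mu> - block22 W"
    and q_def: "q = 2 *\<^sub>R c + diag_adj B \<mu> *v vec 1 - 2 *\<^sub>R block21 W"
    and kkt_stationary: "2 *\<^sub>R (L ** R) + outer q e1 - transpose A ** lam = 0"
    and kkt_affine: "A ** R = outer b e1"
    and kkt_diag: "diag_on B (R ** transpose R) - restr B (R *v e1) = 0"
    and Ad_def: "Ad = transpose A ** matrix_inv (A ** transpose A)"
    and J_def: "J = mat 1 - Ad ** A"
    and lambda1_def: "lam1 = transpose Ad *v (q + L *v (Ad *v b))"
    and lambda2_def: "lam2 = transpose Ad ** L ** (2 *\<^sub>R mat 1 - Ad ** A)"
    and alpha_def: "\<alpha> = - ((J *v (R *v e1)) \<bullet> (L *v (J *v (R *v e1)))) - block11 W"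
    and y_def: "y = (lam1, lam2, \<mu>, \<alpha>)"
    and S_def: "S = C - sym_adjoint (constr_op A b B) y - W"
  shows
    "S = vstack (- (R *v e1)) (mat 1) ** (J ** L ** J) ** hstack (- (R *v e1)) (mat 1)
     \<and> \<comment> \<open>KKT conditions of the factorized problem over the set N\<close>
     (2 *\<^sub>R (L ** R) + outer q e1
        - (outer (transpose A *v lam1) e1 + transpose A ** lam2 ** R
           + transpose lam2 ** A ** R - outer (transpose lam2 *v b) e1) = 0
      \<and> A *v (R *v e1) = b
      \<and> A ** R ** transpose R = outer b (R *v e1)
      \<and> diag_on B (R ** transpose R) = restr B (R *v e1))
     \<and> \<comment> \<open>KKT conditions, except S psd, of the problem in Y\<close>
     (constr_op A b B Y = constr_rhs b
      \<and> psd Y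
      \<and> C - sym_adjoint (constr_op A b B) y - S - W = 0
      \<and> S \<bullet> Y = 0)
     \<and> \<comment> \<open>KKT conditions, except S psd and Y = Z, of the problem in Y and Z\<close>
     (constr_op A b B Y = constr_rhs b
      \<and> C - sym_adjoint (constr_op A b B) y - S - W = 0
      \<and> Y \<bullet> S = 0
      \<and> psd Y
      \<and> Z \<bullet> W = 0
      \<and> Z \<in> P
      \<and> W \<in> dual_cone P)"
proof -
  let ?x = "R *v e1"
  let ?N = "J ** L ** J"
  have P_closed: "closed P"
    using P_poly by (rule polyhedron_imp_closed)
  have Y_psd: "psd Y"
    unfolding Y_def by (rule psd_gram)
  have Y_blocks: "Y = block_matrix 1 ?x ?x (R ** transpose R)"
    by (simp add: Y_def gram_hat)
  have Z_mem: "Z \<in> P"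
    unfolding Z_def using closest_point_in_set[OF P_closed] P_cone by (auto simp: convex_cone_def)

  \<comment> \<open>By Moreau's decomposition \<open>W / \<sigma>\<close> is the residual \<open>Z - U\<close>, which is orthogonal to \<open>Z\<close>.\<close>
  define U where "U = Y - (1 / \<sigma>) *\<^sub>R Wt"
  have "U \<in> symmetric_matrices"
    using Y_psd Wt_sym by (simp add: U_def psd_def symmetric_matrices_def transpose_diff transpose_scalar)
  moreover have neg_U: "(1 / \<sigma>) *\<^sub>R Wt - Y = - U"
    by (simp add: U_def)
  ultimately have W_eq: "W = \<sigma> *\<^sub>R (Z - U)"
    using moreau_dual_cone[OF P_closed P_cone P_sub]
    by (simp add: W_def[unfolded neg_U] Z_def[folded U_def])
  have ZW: "Z \<bullet> W = 0"
    using closest_point_cone_orthogonal(1)[OF P_closed P_cone, of U]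
    by (simp add: W_eq Z_def[folded U_def] inner_diff_left inner_diff_right inner_commute)
  have W_mem: "W \<in> dual_cone P"
  proof -
    have "conic (dual_cone P)" "dual_cone P \<noteq> {}"
      using convex_cone_dual_cone[of P] by (auto simp: convex_cone_def)
    then show ?thesis
      unfolding W_def using sigma_pos closest_point_in_set[OF closed_dual_cone]
      by (intro conicD) auto
  qed
  then have W_sym: "W \<in> symmetric_matrices"
    by (simp add: dual_cone_def)
  note W_blocks = symmetric_block_decomposition[OF W_sym]

  have L_sym: "transpose L = L"
    using Q_sym W_blocks(3) by (simp add: L_def transpose_diff diag_adj_symmetric symmetric_matrices_def)
  note right_inv = full_row_rank_pseudoinverse(1)[OF A_rank Ad_def]
    and M_sym = full_row_rank_pseudoinverse(2)[OF A_rank Ad_def]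
  have J_sym: "transpose J = J"
    by (simp add: J_def transpose_diff M_sym)
  have JAt: "J ** transpose A = 0"
  proof -
    have "transpose (J ** transpose A) = A ** J"
      by (simp add: matrix_transpose_mul J_sym)
    also have "\<dots> = transpose 0"
      by (simp add: J_def matrix_bilinear_simps matrix_mul_assoc right_inv)
        (simp add: transpose_def vec_eq_iff)
    finally show ?thesis
      by (simp only: transpose_iff)
  qed
  \<comment> \<open>By feasibility the columns of \<open>R\<close> other than the first lie in the null space of \<open>A\<close>,
    so \<open>J\<close> changes only the first.\<close>
  have JR: "J ** R = R - outer (Ad *v b) e1"
    by (simp add: J_def matrix_bilinear_simps matrix_mul_assoc[symmetric] kkt_affine matrix_mult_outer)
  have Jx: "J *v ?x = ?x - Ad *v b"
    using arg_cong[OF JR, of "\<lambda>M. M *v e1"]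
    by (simp add: matrix_vector_bilinear_simps outer_mult_vector matrix_vector_mul_assoc)
  have stat: "2 *\<^sub>R (L ** R) + outer q e1 = transpose A ** lam"
    using kkt_stationary by simp
  note proj = projected_stationarity[OF stat JAt]
  note blocks = slack_blocks[OF L_sym M_sym J_def Jx proj(2) lambda1_def lambda2_def]

  have N_sym: "transpose ?N = ?N"
    by (simp add: matrix_transpose_mul J_sym L_sym matrix_mul_assoc)
  have S_eq: "S = vstack (- ?x) (mat 1) ** ?N ** hstack (- ?x) (mat 1)"
  proof -
    let ?v = "(1/2) *\<^sub>R (transpose A *v lam1 - transpose lam2 *v b - restr B \<mu>)"
    let ?G = "(1/2) *\<^sub>R (transpose A ** lam2 + transpose lam2 ** A) + diag_adj B \<mu>"
    have "S = block_matrix 0 c c Q - block_matrix \<alpha> ?v ?v ?G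
              - block_matrix (block11 W) (block21 W) (block21 W) (block22 W)"
      unfolding S_def C_def y_def sym_adjoint_constr_op using W_blocks(1) by simp
    moreover have "c - ?v - block21 W = - (?N *v ?x)"
    proof -
      have "c - ?v - block21 W = (1/2) *\<^sub>R (q - transpose A *v lam1 + transpose lam2 *v b)"
        unfolding q_def diag_adj_mult_ones by (simp add: algebra_simps del: transpose_matrix_vector)
      then show ?thesis
        by (simp add: blocks(2) del: transpose_matrix_vector)
    qed
    moreover have "Q - ?G - block22 W = ?N"
      using blocks(1) by (simp add: L_def algebra_simps)
    \<comment> \<open>\<open>\<alpha>\<close> enters only the corner of the adjoint; its definition is this equation solved for \<open>\<alpha>\<close>.\<close>
    moreover have "0 - \<alpha> - block11 W = ?x \<bullet> (?N *v ?x)"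
      using inner_matrix_vector_left[of J ?x "L *v (J *v ?x)"] J_sym
      by (simp add: alpha_def matrix_vector_mul_assoc matrix_mul_assoc)
    ultimately have "S = block_matrix (?x \<bullet> (?N *v ?x)) (- (?N *v ?x)) (- (?N *v ?x)) ?N"
      by (simp only: block_matrix_diff)
    moreover have "M *v - v = - (M *v v)" for M :: "real^'n^'n" and v
      using matrix_vector_mult_scaleR[of M "-1" v] by simp
    ultimately show ?thesis
      by (simp add: vstack_mult[of "- ?x" "mat 1" ?N] vstack_mult_hstack N_sym inner_commute del: transpose_matrix_vector)
  qed
  \<comment> \<open>\<open>S\<close> need not be semidefinite, so complementarity comes from the stronger \<open>S R\<^sub>h = 0\<close>,
    where \<open>R\<^sub>h\<close> is the factor of \<open>Y\<close>.\<close>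
  have "S ** hat R = 0"
    unfolding S_eq by (rule slack_annihilates_factor[OF JR proj(1)])
  then have SY: "S \<bullet> Y = 0"
    by (simp add: Y_def matrix_inner_mult_right)

  have Ax: "A *v ?x = b"
    by (simp add: matrix_vector_mul_assoc kkt_affine outer_mult_vector)
  have ARR: "A ** R ** transpose R = outer b ?x"
    by (simp add: kkt_affine outer_mult_transpose)
  have feasible: "constr_op A b B Y = constr_rhs b"
    using Ax ARR kkt_diag by (simp add: constr_op_def constr_rhs_def Y_blocks matrix_mul_assoc)
  have lifted: "2 *\<^sub>R (L ** R) + outer q e1
        - (outer (transpose A *v lam1) e1 + transpose A ** lam2 ** R
           + transpose lam2 ** A ** R - outer (transpose lam2 *v b) e1) = 0"
    unfolding lifted_stationarity[OF stat kkt_affine right_inv M_sym lambda1_def lambda2_def] by simp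
  have dual: "C - sym_adjoint (constr_op A b B) y - S - W = 0"
    by (simp add: S_def)
  have "diag_on B (R ** transpose R) = restr B ?x"
    using kkt_diag by simp
  moreover have "Y \<bullet> S = 0"
    using SY by (simp only: inner_commute)
  ultimately show ?thesis
    using S_eq lifted Ax ARR feasible Y_psd dual SY ZW Z_mem W_mem by blast
qed

end
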